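(* Let $u\in[2]^n$ be a word of length $n$ over $\{1,2\}$ with $1\le m_2(u)<m_1(u)$. Then for a word $w$ over the positive integers, $w\in C(u)$ if and only if both of the following hold: (a) $c_2(w)=c_2(u)\le c_1(w)$, or $c_1(w)=c_2(w)<c_2(u)$; (b) $\max R_i(w)\le 2$ for $i\le 2$.
   Context: Juxtaposition denotes concatenation of words. $P(w)$ is the insertion tableau of $w$ under the Robinson–Schensted–Knuth (row-insertion) correspondence, and $C(u)=\{w : P(uw)=P(wu)\}$. $R_i(w)$ denotes the $i$th row of $P(w)$ (empty if $P(w)$ has fewer than $i$ rows; the condition $\max R_i(w)\le2$ holds vacuously for an empty row). $m_a(u)$ is the number of occurrences of the letter $a$ in $u$. For a positive integer $a$, $c_a(w)$ is the number of singleton $a$-columns of $P(w)$, i.e. columns of $P(w)$ of length exactly one whose sole entry is $a$. *)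

theory Defs
  imports Main
begin

type_synonym word = "nat list"

text \<open>A tableau is the list of its rows, the first row coming first.\<close>

type_synonym tableau = "nat list list"

text \<open>Row insertion of \<open>x\<close>: it replaces the leftmost entry strictly larger than \<open>x\<close>, which is
  returned as the bumped letter, or it is appended if there is no such entry.\<close>

fun row_insert :: "nat \<Rightarrow> nat list \<Rightarrow> nat list \<times> nat option" where
  "row_insert x [] = ([x], None)"
| "row_insert x (y # ys) =
     (if x < y then (x # ys, Some y)
      else (case row_insert x ys of (ys', b) \<Rightarrow> (y # ys', b)))"

fun tableau_insert :: "nat \<Rightarrow> tableau \<Rightarrow> tableau" where
  "tableau_insert x [] = [[x]]"
| "tableau_insert x (r # rs) =
     (case row_insert x r of
        (r', None) \<Rightarrow> r' # rs
      | (r', Some y) \<Rightarrow> r' # tableau_insert y rs)"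

text \<open>Letters are inserted from left to right.\<close>

definition insertion_tableau :: "word \<Rightarrow> tableau" where
  "insertion_tableau w = fold tableau_insert w []"

text \<open>The letters of a word are positive integers, hence the exclusion of \<open>0\<close>.\<close>

definition positive_word :: "word \<Rightarrow> bool" where
  "positive_word w \<longleftrightarrow> (\<forall>a\<in>set w. 0 < a)"

definition plactic_centralizer :: "word \<Rightarrow> word set" where
  "plactic_centralizer u =
     {w. positive_word w \<and> insertion_tableau (u @ w) = insertion_tableau (w @ u)}"

text \<open>The \<open>i\<close>-th row of the insertion tableau, numbered from \<open>1\<close>.\<close>

definition tableau_row :: "nat \<Rightarrow> word \<Rightarrow> nat list" where
  "tableau_row i w =
     (if 1 \<le> i \<and> i \<le> length (insertion_tableau w) then insertion_tableau w ! (i - 1) else [])"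

text \<open>The \<open>j\<close>-th column, numbered from \<open>0\<close> and read from the first row onwards; it is empty
  when \<open>j\<close> is not the index of a column of the tableau.\<close>

definition tableau_column :: "nat \<Rightarrow> tableau \<Rightarrow> nat list" where
  "tableau_column j T = map (\<lambda>r. r ! j) (filter (\<lambda>r. j < length r) T)"

definition singleton_columns :: "nat \<Rightarrow> word \<Rightarrow> nat" where
  "singleton_columns a w = card {j. tableau_column j (insertion_tableau w) = [a]}"

end

theory Submission
  imports Defs
begin

text \<open>Multiplying a word \<open>w\<close> on the left by the letter 1 prepends 1 to the first row of \<open>P(w)\<close>, and
  multiplying on the left by 2 is column insertion of 2, which alters only the first two rows. Hence
  \<open>P(uw)\<close> and \<open>P(w)\<close> agree from the third row on. If \<open>u\<close> and \<open>w\<close> commute, then inserting \<open>u\<close>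
  into \<open>P(w)\<close> bumps nothing out of the second row. Left multiplication does not
  decrease the number of letters above 2 in the first row, whereas inserting a 2 from the right
  decreases it if it is positive; so the first row of \<open>P(w)\<close> has letters 1 and 2 only. If the second
  row contained a larger letter, then no 2 could be bumped out of the first row, which forces it to
  consist of ones; but then the last 2 of \<open>u\<close>, multiplied from the left, either lengthens the second row
  or pushes a letter above 2 into the first. Once both rows are over 1 and 2, the products are
  computed in the bicyclic monoid, with \<open>P(uw) = P(wu)\<close> iff
  \<open>min c\<^sub>2(u) c\<^sub>1(w) = min c\<^sub>2(w) c\<^sub>1(u)\<close>.\<close>

section \<open>Insertion of a letter into one row\<close>

lemma row_insert_None_iff:
  "row_insert x r = (r', None) \<longleftrightarrow> (\<forall>y\<in>set r. y \<le> x) \<and> r' = r @ [x]"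
proof (induction r arbitrary: r')
  case (Cons a r)
  have "row_insert x (a # r) = (r', None) \<longleftrightarrow>
      a \<le> x \<and> (\<exists>s. row_insert x r = (s, None) \<and> r' = a # s)"
    by (auto split: prod.splits)
  then show ?case by (auto simp: Cons.IH)
qed auto

lemma row_insert_Some_iff:
  "row_insert x r = (r', Some y) \<longleftrightarrow>
     (\<exists>as bs. r = as @ y # bs \<and> r' = as @ x # bs \<and> x < y \<and> (\<forall>z\<in>set as. z \<le> x))"
proof (induction r arbitrary: r')
  case (Cons h r)
  show ?case
  proof (cases "x < h")
    case True
    then show ?thesis by (fastforce simp: Cons_eq_append_conv)
  next
    case False
    then have "row_insert x (h # r) = (r', Some y) \<longleftrightarrow>
        (\<exists>s. row_insert x r = (s, Some y) \<and> r' = h # s)"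
      by (auto split: prod.splits)
    also have "\<dots> \<longleftrightarrow> (\<exists>as bs. h # r = as @ y # bs \<and> r' = as @ x # bs \<and> x < y \<and> (\<forall>z\<in>set as. z \<le> x))"
      (is "_ \<longleftrightarrow> ?R")
    proof
      assume "\<exists>s. row_insert x r = (s, Some y) \<and> r' = h # s"
      then obtain as bs where "r = as @ y # bs" "r' = h # as @ x # bs" "x < y" "\<forall>z\<in>set as. z \<le> x"
        using Cons.IH by auto
      then show ?R using False by (intro exI[of _ "h # as"] exI[of _ bs]) auto
    next
      assume ?R
      then show "\<exists>s. row_insert x r = (s, Some y) \<and> r' = h # s"
        using False by (fastforce simp: Cons_eq_append_conv Cons.IH)
    qed
    finally show ?thesis .
  qed
qed simp

lemma sorted_row_insert:
  assumes "row_insert x r = (r', out)" "sorted r"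
  shows "sorted r'"
proof (cases out)
  case None
  then show ?thesis using assms by (auto simp: row_insert_None_iff sorted_append)
next
  case (Some y)
  then obtain as bs where "r = as @ y # bs" "r' = as @ x # bs" "x < y" "\<forall>z\<in>set as. z \<le> x"
    using assms by (auto simp: row_insert_Some_iff)
  then show ?thesis using assms(2) by (fastforce simp: sorted_append)
qed

section \<open>Semistandard pairs of rows\<close>

fun column_strict :: "nat list \<Rightarrow> nat list \<Rightarrow> bool" where
  "column_strict r [] \<longleftrightarrow> True"
| "column_strict [] (y # s) \<longleftrightarrow> False"
| "column_strict (x # r) (y # s) \<longleftrightarrow> x < y \<and> column_strict r s"

lemma column_strict_length: "column_strict r s \<Longrightarrow> length s \<le> length r"
  by (induction r s rule: column_strict.induct) auto

lemma column_strict_append: "column_strict r s \<Longrightarrow> column_strict (r @ t) s"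
  by (induction r s rule: column_strict.induct) auto

lemma column_strict_decrease:
  "column_strict (as @ y # bs) s \<Longrightarrow> x < y \<Longrightarrow> column_strict (as @ x # bs) s"
proof (induction as arbitrary: s)
  case Nil then show ?case by (cases s) auto
next
  case (Cons a as) then show ?case by (cases s) auto
qed

text \<open>The entry of \<open>s\<close> below \<open>y\<close>, if any, exceeds \<open>y\<close>,
  so \<open>y\<close> lands in \<open>s\<close> in its old column or further left. The entry above
  the landing place is then \<open>x\<close> or a letter before \<open>x\<close>, and these are all
  below \<open>y\<close>.\<close>

lemma column_strict_bump:
  assumes "column_strict r s" "sorted r" "sorted s"
    and "row_insert x r = (r', Some y)" "row_insert y s = (s', out)"
  shows "column_strict r' s'"
  using assms
proof (induction r s arbitrary: r' s' rule: column_strict.induct)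
  case (1 r)
  obtain as bs where r: "r = as @ y # bs" "r' = as @ x # bs" "x < y" "\<forall>z\<in>set as. z \<le> x"
    using 1 by (auto simp: row_insert_Some_iff)
  then show ?case using 1 by (cases as) auto
next
  case (3 a r b s)
  show ?case
  proof (cases "x < a")
    case True
    then show ?thesis using 3
      by (auto split: prod.splits if_splits dest: column_strict_decrease[of "[]"])
  next
    case False
    obtain t where t: "row_insert x r = (t, Some y)" "r' = a # t"
      using 3 False by (auto split: prod.splits)
    obtain as bs where r: "r = as @ y # bs" "t = as @ x # bs" "x < y"
      using t by (auto simp: row_insert_Some_iff)
    show ?thesis
    proof (cases "y < b")
      case True
      then show ?thesis using 3 t r False column_strict_decrease[of as y bs s x] by auto
    next
      case False
      then obtain t' where "row_insert y s = (t', out)" "s' = b # t'"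
        using 3 by (auto split: prod.splits)
      then show ?thesis using 3 t by auto
    qed
  qed
qed auto

text \<open>The last component is the letter pushed on to the third row, if any.\<close>

definition insert2 :: "nat \<Rightarrow> nat list \<Rightarrow> nat list \<Rightarrow> nat list \<times> nat list \<times> nat option" where
  "insert2 v r s = (case row_insert v r of
      (r', None) \<Rightarrow> (r', s, None)
    | (r', Some b) \<Rightarrow> (r', row_insert b s))"

definition two_rows :: "nat list \<Rightarrow> nat list \<Rightarrow> bool" where
  "two_rows r s \<longleftrightarrow> sorted r \<and> sorted s \<and> column_strict r s"

lemma two_rows_insert2:
  assumes "two_rows r s" "insert2 v r s = (r', s', out)"
  shows "two_rows r' s'"
proof (cases "row_insert v r")
  case (Pair t o')
  have "sorted t" using assms(1) sorted_row_insert[of v r] Pair by (auto simp: two_rows_def)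
  show ?thesis
  proof (cases o')
    case None
    then show ?thesis using assms Pair \<open>sorted t\<close>
      by (auto simp: two_rows_def insert2_def row_insert_None_iff column_strict_append)
  next
    case (Some b)
    then show ?thesis using assms Pair \<open>sorted t\<close> sorted_row_insert[of b s s' out] column_strict_bump[of r s v t b s' out]
      by (auto simp: two_rows_def insert2_def)
  qed
qed

section \<open>Column insertion and its commutation with row insertion\<close>

text \<open>Schensted column insertion of \<open>c\<close>, valid when \<open>c\<close> is at most every entry of the second
  row. The bumped letter travels along the second row until it is at most the entry above it; from
  there on it shifts the first row, so the rows from the third on never change.\<close>

fun col_insert :: "nat \<Rightarrow> nat list \<Rightarrow> nat list \<Rightarrow> nat list \<times> nat list" where
  "col_insert c [] s = ([c], s)"
| "col_insert c (x # r) s =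
     (if c \<le> x then (c # x # r, s)
      else (case s of [] \<Rightarrow> (x # r, [c])
        | y # s' \<Rightarrow> (case col_insert y r s' of (p, q) \<Rightarrow> (x # p, c # q))))"

lemma col_insert_set:
  "col_insert c r s = (p, q) \<Longrightarrow> set p \<subseteq> set r \<union> insert c (set s)"
  by (induction c r s arbitrary: p q rule: col_insert.induct)
     (fastforce split: if_splits list.splits prod.splits)+

text \<open>This is the case of \<open>insert2_col_insert\<close> below where the two bumping paths cross: the letter
  \<open>b\<close> bumped from the first row by \<open>v\<close> displaces the letter \<open>c\<close> carried by the column insertion.\<close>

lemma col_insert_decrease:
  assumes "col_insert c (as @ b # bs) s = (p, q)" "v < b" "b < c" "\<forall>z\<in>set as. z \<le> v" "sorted (c # s)"
  shows "\<exists>p2. p = as @ b # p2 \<and> col_insert c (as @ v # bs) s = (as @ v # p2, q)"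
  using assms
proof (induction as arbitrary: c s p q)
  case Nil then show ?case by (auto split: list.splits prod.splits)
next
  case (Cons a as)
  then have "a < c" by auto
  show ?case
  proof (cases s)
    case Nil then show ?thesis using Cons \<open>a < c\<close> by auto
  next
    case (Cons y s')
    obtain p' q' where "col_insert y (as @ b # bs) s' = (p', q')" by fastforce
    then show ?thesis using Cons.prems Cons.IH[of y s' p' q'] Cons \<open>a < c\<close> by auto
  qed
qed


lemma row_insert_Some_least:
  assumes "row_insert v r = (r', Some b)" "sorted r"
    and "z \<in> set r" "v < z"
  shows "b \<le> z"
  using assms by (fastforce simp: row_insert_Some_iff sorted_append)

text \<open>Row and column insertion commute. The third assumption keeps the letter bumped
  from the first row away from \<open>c\<close>, which sits at the front of the new second row.\<close>

lemma insert2_col_insert: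
  assumes "two_rows r s" "sorted (c # s)"
    and "\<And>r' b. row_insert v r = (r', Some b) \<Longrightarrow> c \<le> b"
    and "col_insert c r s = (p, q)" "insert2 v r s = (r', s', out)"
    and "col_insert c r' s' = (p', q')"
  shows "insert2 v p q = (p', q', out)"
  using assms
proof (induction c r s arbitrary: p q r' s' p' q' rule: col_insert.induct)
  case (1 c s)
  then show ?case by (auto simp: insert2_def two_rows_def split: if_splits list.splits prod.splits)
next
  case (2 c x r s)
  have srt: "sorted (x # r)" "sorted s" "column_strict (x # r) s" using 2 by (auto simp: two_rows_def)
  show ?case
  proof (cases "c \<le> x")
    case cx: True
    then have pq: "p = c # x # r" "q = s" using 2 by auto
    show ?thesis
    proof (cases "v < x")
      case vx: True
      then have i: "r' = v # r" "row_insert x s = (s', out)"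
        using 2(6) by (auto simp: insert2_def)
      show ?thesis
      proof (cases s)
        case Nil
        then show ?thesis using i vx cx 2 pq srt
          by (cases r) (auto simp: insert2_def)
      next
        case (Cons y t)
        then have "x < y" using srt by auto
        then show ?thesis using i vx cx 2 pq Cons srt
          by (cases r) (auto simp: insert2_def split: if_splits)
      qed
    next
      case False
      then show ?thesis using cx 2 pq
        by (auto simp: insert2_def split: option.splits prod.splits)
    qed
  next
    case cx: False
    then have "x < c" by simp
    have vx: "x \<le> v"
      using 2(4) \<open>x < c\<close> by (cases "v < x") auto
    show ?thesis
    proof (cases s)
      case Nil
      show ?thesis
      proof (cases "row_insert v r")
        case (Pair u o1)
        show ?thesis
        proof (cases o1)
          case None
          then show ?thesis using 2 Nil vx cx Pair by (auto simp: insert2_def)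
        next
          case (Some b)
          then have "c \<le> b" using 2(4)[of "x # u" b] Pair vx by auto
          obtain as bs where "r = as @ b # bs" "u = as @ v # bs" "v < b" "\<forall>z\<in>set as. z \<le> v"
            using Pair Some by (auto simp: row_insert_Some_iff)
          then show ?thesis using 2 Nil vx cx Pair Some \<open>c \<le> b\<close>
            by (cases as) (auto simp: insert2_def)
        qed
      qed
    next
      case (Cons y t)
      obtain p0 q0 where pq0: "col_insert y r t = (p0, q0)" by fastforce
      then have pq: "p = x # p0" "q = c # q0" using 2 cx Cons by auto
      have tr: "two_rows r t" "sorted (y # t)" "c \<le> y"
        using 2 Cons by (auto simp: two_rows_def)
      have p0: "set p0 \<subseteq> set r \<union> insert y (set t)" using col_insert_set[OF pq0] .
      \<comment> \<open>A letter bumped from the new first row passes over the \<open>c\<close>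
        heading the second row. It is either an old letter of \<open>r\<close>, hence at least the
        one bumped from \<open>r\<close>, or one of the letters of \<open>y # t\<close>, all at
        least \<open>c\<close>.\<close>
      have skip: "c \<le> b" if b: "row_insert v p0 = (u, Some b)" for u b
      proof (cases "b \<in> set r")
        case True
        have "v < b" using b by (auto simp: row_insert_Some_iff)
        obtain u' o' where u': "row_insert v r = (u', o')" by fastforce
        with True \<open>v < b\<close> obtain b' where "o' = Some b'"
          by (cases o') (auto simp: row_insert_None_iff)
        moreover have "c \<le> b'" using 2(4)[of "x # u'" b'] u' \<open>o' = Some b'\<close> vx by auto
        moreover have "b' \<le> b" using row_insert_Some_least[of v r u' b' b] u' \<open>o' = Some b'\<close> True \<open>v < b\<close> srt by auto
        ultimately show ?thesis by simp
      next
        case False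
        have "b \<in> set p0" using b by (auto simp: row_insert_Some_iff)
        with False p0 tr show ?thesis by force
      qed
      show ?thesis
      \<comment> \<open>The paths cross exactly when the bumped letter displaces the head
        \<open>y\<close> of the second row.\<close>
      proof (cases "\<exists>u b. row_insert v r = (u, Some b) \<and> b < y")
        case True
        then obtain u b where ub: "row_insert v r = (u, Some b)" "b < y" by auto
        then have cb: "c \<le> b" using 2(4)[of "x # u" b] vx by auto
        have eq: "r' = x # u" "s' = b # t" "out = Some y"
          using 2(6) ub vx Cons by (auto simp: insert2_def)
        obtain as bs where ab: "r = as @ b # bs" "u = as @ v # bs" "v < b" "\<forall>z\<in>set as. z \<le> v"
          using ub by (auto simp: row_insert_Some_iff)
        obtain p2 where p2: "p0 = as @ b # p2" "col_insert y u t = (as @ v # p2, q0)"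
          using col_insert_decrease[of y as b bs t p0 q0 v] ab pq0 ub tr by auto
        have "row_insert v p0 = (as @ v # p2, Some b)"
          using p2 ab by (auto simp: row_insert_Some_iff)
        \<comment> \<open>The head of \<open>u\<close> is below both \<open>b\<close> and
          \<open>y\<close>, so column insertions of \<open>b\<close> and of \<open>y\<close> into
          \<open>u\<close> and \<open>t\<close> differ only in the letter that heads the second
          row.\<close>
        moreover obtain h w where hw: "u = h # w" "h < b"
          using ab by (cases as) auto
        moreover from hw obtain zs where "q0 = y # zs" "col_insert b u t = (as @ v # p2, b # zs)"
          using p2(2) ub(2) by (auto split: list.splits prod.splits)
        ultimately show ?thesis using 2(7) eq pq vx cx cb ub by (auto simp: insert2_def)
      next
        case False
        obtain r1 s1 out1 where i: "insert2 v r t = (r1, s1, out1)" by (metis prod_cases3)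
        have eq: "r' = x # r1" "s' = y # s1" "out = out1"
          using i vx False 2(6) Cons by (auto simp: insert2_def split: option.splits prod.splits if_splits)
        obtain p1 q1 where pq1: "col_insert y r1 s1 = (p1, q1)" by fastforce
        have pq': "p' = x # p1" "q' = c # q1" using 2(7) eq cx pq1 by auto
        \<comment> \<open>Here a bumped letter is at least \<open>y\<close>, which is the condition
          that the induction hypothesis needs for the carried letter \<open>y\<close>.\<close>
        have "insert2 v p0 q0 = (p1, q1, out)" 
          using 2(1)[OF cx Cons tr(1,2) _ pq0 i[folded eq(3)] pq1] False eq by (auto simp: not_less)
        then show ?thesis using skip vx pq pq'
          by (fastforce simp: insert2_def split: option.splits prod.splits)
      qed
    qed
  qed
qed

lemma insert2_first_row_subset:
  "insert2 v r s = (r', s', out) \<Longrightarrow> set r' \<subseteq> insert v (set r)"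
  by (cases "row_insert v r"; cases "snd (row_insert v r)")
     (auto simp: insert2_def row_insert_None_iff row_insert_Some_iff)

section \<open>Insertion tableaux as two rows and a remainder\<close>

text \<open>A tableau as its first row, its second row, and the list of the remaining rows. Missing rows are
  \<open>[]\<close>, so only tableaux without empty rows are determined by this data.\<close>

type_synonym split_rows = "nat list \<times> nat list \<times> tableau"

fun insert3 :: "nat \<Rightarrow> split_rows \<Rightarrow> split_rows" where
  "insert3 x (r, s, T) = (case insert2 x r s of
      (r', s', None) \<Rightarrow> (r', s', T)
    | (r', s', Some z) \<Rightarrow> (r', s', tableau_insert z T))"

declare insert3.simps [simp del]

fun split_tableau :: "tableau \<Rightarrow> split_rows" where
  "split_tableau [] = ([], [], [])"
| "split_tableau [r] = (r, [], [])"
| "split_tableau (r # s # T) = (r, s, T)"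

lemma split_tableau_insert: "split_tableau (tableau_insert x T) = insert3 x (split_tableau T)"
  by (cases T rule: split_tableau.cases) (auto simp: insert3.simps insert2_def split: prod.splits option.splits)

definition word_rows :: "word \<Rightarrow> split_rows" where
  "word_rows w = split_tableau (insertion_tableau w)"

lemma word_rows_append: "word_rows (u @ w) = fold insert3 w (word_rows u)"
  by (induction w rule: rev_induct)
     (auto simp: word_rows_def insertion_tableau_def split_tableau_insert simp flip: append_assoc)

lemma word_rows_Nil: "word_rows [] = ([], [], [])"
  by (simp add: word_rows_def insertion_tableau_def)

lemma word_rows_snoc: "word_rows (w @ [x]) = insert3 x (word_rows w)"
  by (simp add: word_rows_append)

fun semistandard :: "tableau \<Rightarrow> bool" where
  "semistandard [] \<longleftrightarrow> True"
| "semistandard [r] \<longleftrightarrow> r \<noteq> [] \<and> sorted r"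
| "semistandard (r # s # T) \<longleftrightarrow> r \<noteq> [] \<and> two_rows r s \<and> semistandard (s # T)"

lemma row_insert_not_Nil: "row_insert x r = (r', out) \<Longrightarrow> r' \<noteq> []"
  by (cases out) (auto simp: row_insert_None_iff row_insert_Some_iff)

lemma semistandard_tableau_insert: "semistandard T \<Longrightarrow> semistandard (tableau_insert x T)"
proof (induction T arbitrary: x rule: semistandard.induct)
  case (2 r)
  obtain r' out where i: "row_insert x r = (r', out)" by fastforce
  have "r' \<noteq> []" using row_insert_not_Nil[OF i] .
  \<comment> \<open>A lone row is treated as a pair with empty second row, so that
    \<open>two_rows_insert2\<close> applies.\<close>
  have "insert2 x r [] = (r', case out of None \<Rightarrow> [] | Some y \<Rightarrow> [y], None)"
    using i by (simp add: insert2_def split: option.split)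
  moreover have "two_rows r []" using 2 by (simp add: two_rows_def)
  ultimately have "two_rows r' (case out of None \<Rightarrow> [] | Some y \<Rightarrow> [y])"
    using two_rows_insert2 by blast
  then show ?case using i \<open>r' \<noteq> []\<close> by (auto simp: two_rows_def split: option.splits)
next
  case (3 r s T)
  obtain r' out where i: "row_insert x r = (r', out)" by fastforce
  have n: "r' \<noteq> []" using row_insert_not_Nil[OF i] .
  show ?case
  proof (cases out)
    case None
    then show ?thesis using 3 two_rows_insert2[of r s x r' s None] i n by (auto simp: insert2_def)
  next
    case (Some y)
    obtain s' out' where j: "row_insert y s = (s', out')" by fastforce
    have "two_rows r' s'" using two_rows_insert2[of r s x r' s' out'] 3 i j Some by (auto simp: insert2_def)
    moreover have "semistandard (tableau_insert y (s # T))" using 3 by simp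
    ultimately show ?thesis using i j n Some by (auto split: option.splits)
  qed
qed simp

lemma semistandard_insertion_tableau: "semistandard (insertion_tableau w)"
  by (induction w rule: rev_induct) (auto simp: insertion_tableau_def semistandard_tableau_insert)

lemma split_tableau_inject:
  "semistandard T \<Longrightarrow> semistandard T' \<Longrightarrow> split_tableau T = split_tableau T' \<Longrightarrow> T = T'"
proof (cases T rule: split_tableau.cases; cases T' rule: split_tableau.cases)
  fix r s R r'
  show "semistandard T \<Longrightarrow> semistandard T' \<Longrightarrow> split_tableau T = split_tableau T' \<Longrightarrow>
     T = r # s # R \<Longrightarrow> T' = [r'] \<Longrightarrow> T = T'"
   "semistandard T \<Longrightarrow> semistandard T' \<Longrightarrow> split_tableau T = split_tableau T' \<Longrightarrow>
     T = [r'] \<Longrightarrow> T' = r # s # R \<Longrightarrow> T = T'" by (cases R; auto)+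
qed auto

lemma plactic_centralizer_iff:
  "positive_word w \<Longrightarrow> w \<in> plactic_centralizer u \<longleftrightarrow> word_rows (u @ w) = word_rows (w @ u)"
  unfolding plactic_centralizer_def word_rows_def
  using split_tableau_inject[OF semistandard_insertion_tableau semistandard_insertion_tableau] by auto

lemma column_strict_less: "column_strict r s \<Longrightarrow> y \<in> set s \<Longrightarrow> \<exists>x\<in>set r. x < y"
  by (induction r s rule: column_strict.induct) auto

lemma word_rows_two_rows:
  assumes "word_rows w = (r, s, T)"
  shows "two_rows r s"
  using assms semistandard_insertion_tableau[of w]
  by (cases "insertion_tableau w" rule: split_tableau.cases) (auto simp: word_rows_def two_rows_def)

lemma insert3_eq:
  "insert2 x r s = (r', s', out) \<Longrightarrow>
    insert3 x (r, s, T) = (r', s', case out of None \<Rightarrow> T | Some z \<Rightarrow> tableau_insert z T)"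
  by (auto simp: insert3.simps split: option.splits)

section \<open>Left multiplication by 1 and by 2\<close>

lemma word_rows_positive:
  "positive_word w \<Longrightarrow> word_rows w = (r, s, T) \<Longrightarrow> x \<in> set r \<Longrightarrow> 0 < x"
proof (induction w arbitrary: r s T x rule: rev_induct)
  case (snoc v w)
  obtain r0 s0 T0 where w: "word_rows w = (r0, s0, T0)" by (metis prod_cases3)
  obtain r1 s1 out where i: "insert2 v r0 s0 = (r1, s1, out)" by (metis prod_cases3)
  have "r = r1" using snoc w insert3_eq[OF i] by (simp add: word_rows_snoc)
  then show ?case using snoc w insert2_first_row_subset[OF i] by (fastforce simp: positive_word_def)
qed (simp add: word_rows_Nil)

text \<open>Each entry has a positive letter above it. This makes column insertion of 2
  legitimate.\<close>

lemma word_rows_second_row: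
  "positive_word w \<Longrightarrow> word_rows w = (r, s, T) \<Longrightarrow> x \<in> set s \<Longrightarrow> 2 \<le> x"
  using word_rows_positive[of w r s T] column_strict_less[of r s x] word_rows_two_rows[of w r s T]
  by (fastforce simp: two_rows_def)

text \<open>No positive letter bumps a leading 1, so all later insertions take place behind
  it.\<close>

lemma word_rows_Cons_1:
  "positive_word w \<Longrightarrow> word_rows w = (r, s, T) \<Longrightarrow> word_rows (1 # w) = (1 # r, s, T)"
proof (induction w arbitrary: r s T rule: rev_induct)
  case Nil
  then show ?case using word_rows_snoc[of "[]" 1] by (simp add: word_rows_Nil insert3.simps insert2_def)
next
  case (snoc v w)
  obtain r0 s0 T0 where w: "word_rows w = (r0, s0, T0)" by (metis prod_cases3)
  obtain r1 s1 out where i: "insert2 v r0 s0 = (r1, s1, out)" by (metis prod_cases3)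
  have "1 \<le> v" using snoc by (auto simp: positive_word_def)
  then have "insert2 v (1 # r0) s0 = (1 # r1, s1, out)"
    using i by (auto simp: insert2_def split: option.splits prod.splits)
  then show ?case
    using snoc w insert3_eq[OF i] insert3_eq[of v "1 # r0" s0] word_rows_snoc[of "1 # w" v]
    by (simp add: word_rows_snoc positive_word_def)
qed

text \<open>The letters of \<open>w\<close> are added on the right, each commuting with the column
  insertion of 2 by \<open>insert2_col_insert\<close>. The letter passed to the third row is the
  same on both sides, hence so is \<open>T\<close>.\<close>

lemma word_rows_Cons_2:
  "positive_word w \<Longrightarrow> word_rows w = (r, s, T) \<Longrightarrow> col_insert 2 r s = (p, q) \<Longrightarrow>
    word_rows (2 # w) = (p, q, T)"
proof (induction w arbitrary: r s T p q rule: rev_induct)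
  case Nil
  then show ?case using word_rows_snoc[of "[]" 2] by (simp add: word_rows_Nil insert3.simps insert2_def)
next
  case (snoc v w)
  obtain r0 s0 T0 where w: "word_rows w = (r0, s0, T0)" by (metis prod_cases3)
  obtain r1 s1 out where i: "insert2 v r0 s0 = (r1, s1, out)" by (metis prod_cases3)
  obtain p0 q0 where c: "col_insert 2 r0 s0 = (p0, q0)" by fastforce
  have pos: "1 \<le> v" "positive_word w" using snoc by (auto simp: positive_word_def)
  have rs: "r = r1" "s = s1" using snoc w insert3_eq[OF i] by (simp_all add: word_rows_snoc)
  have tr: "two_rows r0 s0" using word_rows_two_rows[OF w] .
  have "insert2 v p0 q0 = (p, q, out)"
  proof (rule insert2_col_insert[OF tr _ _ c i])
    show "sorted (2 # s0)" using tr word_rows_second_row[OF pos(2) w] by (auto simp: two_rows_def)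
    show "2 \<le> b" if "row_insert v r0 = (r', Some b)" for r' b
      using that pos by (auto simp: row_insert_Some_iff)
    show "col_insert 2 r1 s1 = (p, q)" using snoc rs by simp
  qed
  then show ?case
    using snoc w pos insert3_eq[OF i] c insert3_eq[of v p0 q0] word_rows_snoc[of "2 # w" v]
    by (simp add: word_rows_snoc)
qed

section \<open>Monotone quantities under left and right multiplication\<close>

definition large :: "nat list \<Rightarrow> nat" where
  "large r = length (filter (\<lambda>x. 2 < x) r)"

lemma large_pos_iff: "0 < large r \<longleftrightarrow> (\<exists>x\<in>set r. 2 < x)"
  by (induction r) (auto simp: large_def)

text \<open>The first row keeps all its letters and may gain one; in the second row letters are
  replaced or one is added at the end.\<close>

lemma col_insert_mono:
  "col_insert c r s = (p, q) \<Longrightarrow> large r \<le> large p \<and> length s \<le> length q"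
proof (induction c r s arbitrary: p q rule: col_insert.induct)
  case (2 c x r s)
  show ?case
  proof (cases "c \<le> x")
    case False
    show ?thesis
    proof (cases s)
      case Nil
      then show ?thesis using 2 False by auto
    next
      case (Cons y t)
      obtain p' q' where "col_insert y r t = (p', q')" by fastforce
      then show ?thesis using 2 False Cons by (fastforce simp: large_def)
    qed
  qed (use 2 in \<open>auto simp: large_def\<close>)
qed (auto simp: large_def)

lemma word_rows_left:
  assumes "set u \<subseteq> {1, 2}" "positive_word w" "word_rows w = (r, s, T)"
  shows "\<exists>p q. word_rows (u @ w) = (p, q, T) \<and> large r \<le> large p \<and> length s \<le> length q"
  using assms(1)
proof (induction u)
  case (Cons a u)
  then obtain p q where IH: "word_rows (u @ w) = (p, q, T)" "large r \<le> large p" "length s \<le> length q"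
    by auto
  have pos: "positive_word (u @ w)" using Cons assms by (fastforce simp: positive_word_def)
  have "a = 1 \<or> a = 2" using Cons by auto
  then show ?case
  proof
    assume "a = 1"
    then show ?thesis using word_rows_Cons_1[OF pos IH(1)] IH by (auto simp: large_def)
  next
    assume a: "a = 2"
    obtain p' q' where "col_insert 2 p q = (p', q')" by fastforce
    then show ?thesis using word_rows_Cons_2[OF pos IH(1)] IH a col_insert_mono[of 2 p q p' q'] by auto
  qed
qed (use assms in auto)

lemma length_concat_tableau_insert:
  "length (concat (tableau_insert x T)) = Suc (length (concat T))"
proof (induction T arbitrary: x)
  case (Cons r T)
  obtain r' out where i: "row_insert x r = (r', out)" by fastforce
  show ?case
  proof (cases out)
    case None
    then have "r' = r @ [x]" using i by (simp add: row_insert_None_iff)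
    then show ?thesis using i None by simp
  next
    case (Some y)
    then have "length r' = length r" using i by (auto simp: row_insert_Some_iff)
    then show ?thesis using i Some Cons.IH[of y] by simp
  qed
qed simp

text \<open>Every letter leaving the second row adds a cell to the remainder. So if \<open>T\<close>
  comes back unchanged, no letter has left.\<close>

lemma fold_insert3_length:
  "fold insert3 u (r, s, T) = (r', s', T') \<Longrightarrow> length (concat T) \<le> length (concat T')"
proof (induction u arbitrary: r s T)
  case (Cons x u)
  obtain r1 s1 out where i: "insert2 x r s = (r1, s1, out)" by (metis prod_cases3)
  show ?case
    using Cons.prems Cons.IH[of r1 s1 "case out of None \<Rightarrow> T | Some z \<Rightarrow> tableau_insert z T"] insert3_eq[OF i, of T]
    by (auto simp: length_concat_tableau_insert split: option.splits)
qed simp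

text \<open>When a letter above 2 is present, an inserted 2 takes the place of such a
  letter.\<close>

lemma large_row_insert:
  assumes "row_insert v r = (r', out)" "v \<le> 2"
  shows "large r' \<le> large r \<and> (v = 2 \<and> 0 < large r \<longrightarrow> large r' < large r)"
proof (cases out)
  case None
  then have r: "\<forall>y\<in>set r. y \<le> v" "r' = r @ [v]" using assms(1) by (auto simp: row_insert_None_iff)
  then have "large r = 0" using assms(2) large_pos_iff[of r] by fastforce
  then show ?thesis using r assms(2) by (auto simp: large_def)
next
  case (Some b)
  then show ?thesis using assms by (auto simp: row_insert_Some_iff large_def)
qed

text \<open>When a 2 of \<open>u\<close> is inserted, either \<open>large\<close> is still positive
  and drops now, or it has already dropped to 0.\<close>

lemma large_fold_insert3:
  assumes "fold insert3 u (r, s, T) = (r', s', T')" "set u \<subseteq> {1, 2}"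
  shows "large r' \<le> large r \<and> (2 \<in> set u \<and> 0 < large r \<longrightarrow> large r' < large r)"
  using assms
proof (induction u arbitrary: r s T)
  case (Cons x u)
  obtain r1 s1 out where i: "insert2 x r s = (r1, s1, out)" by (metis prod_cases3)
  have IH: "large r' \<le> large r1 \<and> (2 \<in> set u \<and> 0 < large r1 \<longrightarrow> large r' < large r1)"
    using Cons insert3_eq[OF i, of T] by auto
  obtain o1 where "row_insert x r = (r1, o1)"
    using i by (auto simp: insert2_def split: option.splits prod.splits)
  then have "large r1 \<le> large r \<and> (x = 2 \<and> 0 < large r \<longrightarrow> large r1 < large r)"
    using large_row_insert Cons.prems by auto
  with IH show ?case by auto
qed simp

section \<open>The first two rows of a commuting word\<close>

lemma subset_one_two_iff: "A \<subseteq> {1, 2::nat} \<longleftrightarrow> (\<forall>x\<in>A. 0 < x \<and> x \<le> 2)"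
proof -
  have "x = 1 \<or> x = 2 \<longleftrightarrow> 0 < x \<and> x \<le> 2" for x :: nat by arith
  then show ?thesis by auto
qed

lemma sorted_two_letters:
  fixes r :: "nat list"
  shows "sorted r \<Longrightarrow> set r \<subseteq> {1, 2} \<Longrightarrow> \<exists>a b. r = replicate a 1 @ replicate b 2"
proof (induction r)
  case (Cons x r)
  then obtain a b where r: "r = replicate a 1 @ replicate b 2" by auto
  show ?case
  proof (cases "x = 1")
    case True
    then show ?thesis using r by (intro exI[of _ "Suc a"] exI[of _ b]) auto
  next
    case False
    then have "x = 2" using Cons.prems by simp
    moreover have "a = 0" using Cons.prems r \<open>x = 2\<close> by (cases a) simp_all
    ultimately show ?thesis using r by (intro exI[of _ 0] exI[of _ "Suc b"]) auto
  qed
qed simp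

lemma row_insert_1_two_letters:
  "row_insert 1 (replicate a 1 @ replicate (Suc b) 2) = (replicate (Suc a) 1 @ replicate b 2, Some 2)"
  by (induction a) auto

lemma row_insert_1_ones: "row_insert 1 (replicate a 1) = (replicate (Suc a) 1, None)"
  by (induction a) auto

lemma row_insert_2_two_letters:
  "row_insert 2 (replicate a 1 @ replicate b 2) = (replicate a 1 @ replicate (Suc b) 2, None)"
  by (auto simp: row_insert_None_iff replicate_append_same)

lemma row_insert_2_twos: "row_insert 2 (replicate d 2) = (replicate (Suc d) 2, None)"
  using row_insert_2_two_letters[of 0 d] by simp

text \<open>A 1 inserted while the first row contains a 2 bumps that 2 into the second row, where a
  letter above 2 must give way and enlarge \<open>T\<close>. As \<open>T\<close> is the same at the
  end, this never happens.\<close>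

lemma fold_insert3_two_letters_no_bump:
  assumes "fold insert3 u (replicate a 1 @ replicate b 2, s, T) = (r', s', T)"
    and "sorted s" "y \<in> set s" "2 < y" "set u \<subseteq> {1, 2}"
  shows "s' = s \<and> (0 < b \<longrightarrow> 1 \<notin> set u)"
  using assms(1,5)
proof (induction u arbitrary: a b)
  case (Cons x u)
  consider "x = 2" | "x = 1" "b = 0" | b' where "x = 1" "b = Suc b'" using Cons.prems by (cases b) auto
  then show ?case
  proof cases
    case 1
    then have "insert3 x (replicate a 1 @ replicate b 2, s, T) = (replicate a 1 @ replicate (Suc b) 2, s, T)"
      using row_insert_2_two_letters[of a b] by (simp add: insert3.simps insert2_def)
    then show ?thesis using Cons.IH[of a "Suc b"] Cons.prems 1 by auto
  next
    case 2
    then have "insert3 x (replicate a 1 @ replicate b 2, s, T) = (replicate (Suc a) 1 @ replicate 0 2, s, T)"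
      using row_insert_1_ones[of a] by (simp add: insert3.simps insert2_def)
    then show ?thesis using Cons.IH[of "Suc a" 0] Cons.prems 2 by auto
  next
    case 3
    obtain t out where i: "row_insert 2 s = (t, out)" by fastforce
    then obtain z where z: "out = Some z"
      using assms(3,4) by (cases out) (auto simp: row_insert_None_iff)
    have "insert3 x (replicate a 1 @ replicate b 2, s, T)
        = (replicate (Suc a) 1 @ replicate b' 2, t, tableau_insert z T)"
      using row_insert_1_two_letters[of a b'] 3 i z by (simp add: insert3.simps insert2_def)
    then have "length (concat (tableau_insert z T)) \<le> length (concat T)"
      using Cons.prems by (auto dest: fold_insert3_length)
    \<comment> \<open>The insertion of \<open>z\<close> has added a cell, so the inequality is
      absurd.\<close>
    then show ?thesis by (simp add: length_concat_tableau_insert)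
  qed
qed simp

text \<open>Every carried letter exceeds the 1 it meets, so it moves into the second row and
  displaces the next letter of \<open>s\<close>. The last one, \<open>last (c # s)\<close>,
  lengthens the second row, or ends in the first row if no column is left.\<close>

lemma col_insert_ones:
  "col_insert c (replicate a 1) s = (p, q) \<Longrightarrow> 1 < c \<Longrightarrow> sorted (c # s) \<Longrightarrow> length s \<le> a \<Longrightarrow>
    length q = Suc (length s) \<or> last (c # s) \<in> set p"
proof (induction a arbitrary: c s p q)
  case (Suc a)
  show ?case
  proof (cases s)
    case Nil
    then show ?thesis using Suc.prems by auto
  next
    case (Cons y t)
    obtain p' q' where "col_insert y (replicate a 1) t = (p', q')" by fastforce
    then show ?thesis using Suc.prems Suc.IH[of y t p' q'] Cons by auto
  qed
qed auto

lemma word_rows_ones: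
  "positive_word w \<Longrightarrow> word_rows w = (r, s, T) \<Longrightarrow> set u \<subseteq> {1} \<Longrightarrow>
    word_rows (u @ w) = (replicate (length u) 1 @ r, s, T)"
proof (induction u)
  case (Cons a u)
  have "positive_word (u @ w)" using Cons.prems by (auto simp: positive_word_def)
  then show ?case using Cons word_rows_Cons_1[of "u @ w"] by auto
qed simp

lemma commuting_rows:
  assumes "positive_word w" "set u \<subseteq> {1, 2}" "1 \<in> set u" "2 \<in> set u"
    and comm: "word_rows (u @ w) = word_rows (w @ u)" and w: "word_rows w = (r, s, T)"
  shows "\<forall>x\<in>set r \<union> set s. x \<le> 2"
proof -
  have tr: "two_rows r s" using word_rows_two_rows[OF w] .
  obtain p q where uw: "word_rows (u @ w) = (p, q, T)" "large r \<le> large p"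
    using word_rows_left[OF assms(2,1) w] by auto
  then have wu: "fold insert3 u (r, s, T) = (p, q, T)"
    using comm w by (simp add: word_rows_append)
  have le: "large p \<le> large r \<and> (2 \<in> set u \<and> 0 < large r \<longrightarrow> large p < large r)"
    using large_fold_insert3[OF wu assms(2)] .
  \<comment> \<open>Since \<open>u\<close> contains a 2, a positive \<open>large r\<close> would
    give \<open>large p < large r\<close>, against the bound from the left.\<close>
  have r0: "large r = 0" "large p = 0" using le uw(2) assms(4) by auto
  have r2: "\<forall>x\<in>set r. x \<le> 2" using r0(1) large_pos_iff[of r] by (auto simp: not_less)
  have "\<forall>y\<in>set s. y \<le> 2"
  proof (rule ccontr)
    assume "\<not> ?thesis"
    then obtain y where y: "y \<in> set s" "2 < y" by (auto simp: not_le)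
    have "set r \<subseteq> {1, 2}"
      using subset_one_two_iff r2 word_rows_positive[OF assms(1) w] by blast
    then obtain a b where r: "r = replicate a 1 @ replicate b 2"
      using sorted_two_letters[of r] tr by (auto simp: two_rows_def)
    have "q = s" "b = 0"
      using fold_insert3_two_letters_no_bump[of u a b s T p q y] wu r y tr assms
      by (auto simp: two_rows_def)
    \<comment> \<open>After the last 2 of \<open>u\<close> only ones follow, so the first row of
      \<open>u2 @ w\<close> still consists of ones when this 2 is multiplied from the left.\<close>
    obtain u1 u2 where u: "u = u1 @ 2 # u2" "2 \<notin> set u2" using split_list_last[OF assms(4)] by auto
    then have "set u2 \<subseteq> {1}" "set u1 \<subseteq> {1, 2}" using assms(2) by auto
    have pos: "positive_word (u2 @ w)" "positive_word (2 # u2 @ w)"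
      using assms(1) \<open>set u2 \<subseteq> {1}\<close> by (auto simp: positive_word_def)
    define n where "n = length u2 + a"
    have u2: "word_rows (u2 @ w) = (replicate n 1, s, T)"
      using word_rows_ones[OF assms(1) w \<open>set u2 \<subseteq> {1}\<close>] r \<open>b = 0\<close> by (simp add: n_def replicate_add)
    obtain p1 q1 where c: "col_insert 2 (replicate n 1) s = (p1, q1)" by fastforce
    have "word_rows (2 # u2 @ w) = (p1, q1, T)" using word_rows_Cons_2[OF pos(1) u2 c] .
    then have *: "large p1 \<le> large p" "length q1 \<le> length q"
      using word_rows_left[OF \<open>set u1 \<subseteq> {1, 2}\<close> pos(2)] u uw(1) by auto
    have "length s \<le> a" using tr r \<open>b = 0\<close> by (auto simp: two_rows_def dest: column_strict_length)
    moreover have "sorted (2 # s)"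
      using tr word_rows_second_row[OF assms(1) w] by (auto simp: two_rows_def)
    ultimately have "length q1 = Suc (length s) \<or> last (2 # s) \<in> set p1"
      using col_insert_ones[OF c] by (simp add: n_def)
    moreover have "2 < last (2 # s)"
    proof -
      have "s \<noteq> []" using y by auto
      then have "sorted (butlast s @ [last s])" "y \<in> set (butlast s @ [last s])"
        using tr y by (simp_all add: two_rows_def)
      then have "y \<le> last s" by (auto simp: sorted_append simp del: append_butlast_last_id)
      then show ?thesis using y \<open>s \<noteq> []\<close> by simp
    qed
    \<comment> \<open>A longer second row contradicts \<open>length q1 \<le> length q\<close> with
      \<open>q = s\<close>; a letter above 2 in \<open>p1\<close> contradicts
      \<open>large p = 0\<close>.\<close>
    ultimately show False using * r0(2) \<open>q = s\<close> large_pos_iff[of p1] by auto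
  qed
  then show ?thesis using r2 by auto
qed

section \<open>Products over two letters\<close>

text \<open>Here \<open>e\<close> and \<open>b\<close> count the singleton columns 1 and 2, and \<open>d\<close> counts the columns starting with
  1, 2. On \<open>(e, b)\<close> multiplication by letters acts as in the bicyclic monoid: a 2 cancels against
  a 1 to its right.\<close>

definition two_letter_rows :: "nat \<Rightarrow> nat \<Rightarrow> nat \<Rightarrow> tableau \<Rightarrow> split_rows" where
  "two_letter_rows e b d T = (replicate (e + d) 1 @ replicate b 2, replicate d 2, T)"

lemma count_list_replicate: "count_list (replicate n x) y = (if x = y then n else 0)"
  by (induction n) auto

lemma two_letter_rows_inject:
  "two_letter_rows e b d T = two_letter_rows e' b' d' T' \<longleftrightarrow> e = e' \<and> b = b' \<and> d = d' \<and> T = T'"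
proof
  assume eq: "two_letter_rows e b d T = two_letter_rows e' b' d' T'"
  then have r: "replicate (e + d) (1::nat) @ replicate b 2 = replicate (e' + d') 1 @ replicate b' 2"
    and d: "d = d'" "T = T'"
    by (auto simp: two_letter_rows_def dest: arg_cong[where f = length])
  have "count_list (replicate (e + d) (1::nat) @ replicate b 2) x
      = count_list (replicate (e' + d') 1 @ replicate b' 2) x" for x using r by simp
  from this[of 1] this[of 2] show "e = e' \<and> b = b' \<and> d = d' \<and> T = T'"
    using d by (simp add: count_list_replicate)
qed simp

text \<open>The carried 2 is exchanged for an equal 2 in each of the \<open>d\<close> full columns.
  It then completes a singleton 1 to a column 1, 2, or joins the twos of the first row if
  \<open>e = 0\<close>.\<close>

lemma col_insert_two_letter_rows:
  "col_insert 2 (replicate (e + d) 1 @ replicate b 2) (replicate d 2) =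
     (case e of 0 \<Rightarrow> (replicate d 1 @ replicate (Suc b) 2, replicate d 2)
        | Suc e' \<Rightarrow> (replicate (e + d) 1 @ replicate b 2, replicate (Suc d) 2))"
proof (induction d)
  case 0
  then show ?case by (cases e; cases b) auto
qed (auto split: nat.splits)

lemma word_rows_Cons_1_two_letters:
  "positive_word w \<Longrightarrow> word_rows w = two_letter_rows e b d T \<Longrightarrow>
    word_rows (1 # w) = two_letter_rows (Suc e) b d T"
  by (auto simp: two_letter_rows_def dest: word_rows_Cons_1)

lemma word_rows_Cons_2_two_letters:
  assumes "positive_word w" "word_rows w = two_letter_rows e b d T"
  shows "word_rows (2 # w) =
    (if 0 < e then two_letter_rows (e - 1) b (Suc d) T else two_letter_rows 0 (Suc b) d T)"
  using word_rows_Cons_2[OF assms(1) assms(2)[unfolded two_letter_rows_def]] col_insert_two_letter_rows[of e d b]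
  by (cases e) (auto simp: two_letter_rows_def)

lemma insert3_1_two_letters:
  "insert3 1 (two_letter_rows e b d T) =
    (if 0 < b then two_letter_rows e (b - 1) (Suc d) T else two_letter_rows (Suc e) 0 d T)"
proof (cases b)
  case 0
  then show ?thesis using row_insert_1_ones[of "e + d"]
    by (simp add: two_letter_rows_def insert3.simps insert2_def)
next
  case (Suc b')
  then show ?thesis using row_insert_1_two_letters[of "e + d" b'] row_insert_2_twos[of d]
    by (simp add: two_letter_rows_def insert3.simps insert2_def)
qed

lemma insert3_2_two_letters: "insert3 2 (two_letter_rows e b d T) = two_letter_rows e (Suc b) d T"
  using row_insert_2_two_letters[of "e + d" b]
  by (simp add: two_letter_rows_def insert3.simps insert2_def)

text \<open>The parameters \<open>p\<close>, \<open>q\<close>, \<open>k\<close> of \<open>u\<close>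
  also describe its left action: \<open>min q e\<close> of its free twos pair with free ones of
  \<open>w\<close>. Proving both in one induction keeps the parameters the same.\<close>

lemma word_rows_two_letters_left:
  assumes "set u \<subseteq> {1, 2}"
  shows "\<exists>p q k. word_rows u = two_letter_rows p q k [] \<and> count_list u 1 = p + k \<and> count_list u 2 = q + k
    \<and> (\<forall>w e b d T. positive_word w \<longrightarrow> word_rows w = two_letter_rows e b d T \<longrightarrow>
        word_rows (u @ w) = two_letter_rows (p + (e - q)) (b + (q - e)) (d + k + min q e) T)"
  using assms
proof (induction u)
  case Nil
  show ?case by (intro exI[of _ 0]) (auto simp: word_rows_Nil two_letter_rows_def)
next
  case (Cons a u)
  then obtain p q k where u: "word_rows u = two_letter_rows p q k []"
      "count_list u 1 = p + k" "count_list u 2 = q + k"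
    and w: "\<And>w e b d T. positive_word w \<Longrightarrow> word_rows w = two_letter_rows e b d T \<Longrightarrow>
        word_rows (u @ w) = two_letter_rows (p + (e - q)) (b + (q - e)) (d + k + min q e) T"
    by auto
  have pos: "positive_word u" "\<And>w. positive_word w \<Longrightarrow> positive_word (u @ w)"
    using Cons.prems by (fastforce simp: positive_word_def)+
  note one = word_rows_Cons_1_two_letters and two = word_rows_Cons_2_two_letters
  \<comment> \<open>A new 2 on the left pairs with a free 1 of \<open>u\<close> when there is
    one.\<close>
  consider "a = 1" | "a = 2" "0 < p" | "a = 2" "p = 0" using Cons.prems by auto
  then show ?case
  proof cases
    case 1
    show ?thesis
      by (intro exI[of _ "Suc p"] exI[of _ q] exI[of _ k] conjI allI impI)
         (use 1 u one[OF pos(1) u(1)] one[OF pos(2) w] in auto)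
  next
    case 2
    show ?thesis
      by (intro exI[of _ "p - 1"] exI[of _ q] exI[of _ "Suc k"] conjI allI impI)
         (use 2 u two[OF pos(1) u(1)] two[OF pos(2) w] in \<open>auto simp: two_letter_rows_inject\<close>)
  next
    case 3
    show ?thesis
      by (intro exI[of _ 0] exI[of _ "Suc q"] exI[of _ k] conjI allI impI)
         (use 3 u two[OF pos(1) u(1)] two[OF pos(2) w] in \<open>auto simp: two_letter_rows_inject\<close>)
  qed
qed

text \<open>This is the mirror image: the \<open>p\<close> free ones of \<open>u\<close> pair with
  the \<open>b\<close> free twos to their left. An appended 1 first uses up the free twos of
  \<open>u\<close> itself.\<close>

lemma fold_insert3_two_letters:
  assumes "set u \<subseteq> {1, 2}" "word_rows u = two_letter_rows p q k []"
  shows "fold insert3 u (two_letter_rows e b d T) =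
    two_letter_rows (e + (p - b)) (q + (b - p)) (d + k + min b p) T"
  using assms
proof (induction u arbitrary: p q k rule: rev_induct)
  case Nil
  then have "two_letter_rows 0 0 0 [] = two_letter_rows p q k []"
    by (simp add: word_rows_Nil two_letter_rows_def)
  then show ?case by (simp add: two_letter_rows_inject)
next
  case (snoc a u)
  then obtain p' q' k' where u: "word_rows u = two_letter_rows p' q' k' []"
    using word_rows_two_letters_left[of u] by auto
  have "a = 1 \<or> a = 2" using snoc.prems by auto
  then show ?case
    using snoc.prems snoc.IH[OF _ u] u
    by (auto simp: word_rows_snoc insert3_1_two_letters[unfolded One_nat_def] insert3_2_two_letters
        two_letter_rows_inject split: if_splits)
qed

section \<open>Singleton columns and the final criterion\<close>

text \<open>Row lengths decrease weakly, so a column not reached by the second row is not reached by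
  any later one.\<close>

lemma split_tableau_singleton_column:
  assumes "semistandard T" "split_tableau T = (r, s, R)"
  shows "tableau_column j T = [a] \<longleftrightarrow> length s \<le> j \<and> j < length r \<and> r ! j = a"
proof (cases T rule: split_tableau.cases)
  case (3 r' s' R')
  have "semistandard (s # T) \<Longrightarrow> t \<in> set T \<Longrightarrow> length t \<le> length s" for s t T
    by (induction T arbitrary: s) (auto simp: two_rows_def dest!: column_strict_length intro: order.trans)
  then have len: "\<forall>t\<in>set R. length t \<le> length s" "length s \<le> length r"
    using assms 3 by (auto simp: two_rows_def column_strict_length)
  have "filter (\<lambda>t. j < length t) R = []" if "length s \<le> j"
    using len that by (fastforce simp: filter_empty_conv)
  then show ?thesis using assms 3 len by (auto simp: tableau_column_def)
qed (use assms in \<open>auto simp: tableau_column_def\<close>)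

lemma singleton_columns_two_letter_rows:
  assumes "word_rows w = two_letter_rows e b d T"
  shows "singleton_columns 1 w = e" "singleton_columns 2 w = b"
proof -
  define r where "r = replicate (e + d) (1::nat) @ replicate b 2"
  have col: "tableau_column j (insertion_tableau w) = [a] \<longleftrightarrow> d \<le> j \<and> j < e + d + b \<and> r ! j = a" for j a
    using split_tableau_singleton_column[OF semistandard_insertion_tableau, of w r "replicate d 2" T j a] assms
    by (simp add: word_rows_def two_letter_rows_def r_def)
  have nth: "r ! j = (if j < e + d then 1 else 2)" if "j < e + d + b" for j
    using that by (simp add: r_def nth_append)
  have "{j. tableau_column j (insertion_tableau w) = [1]} = {d..<d + e}"
    unfolding col by (auto simp: nth split: if_splits)
  then show "singleton_columns 1 w = e" by (simp add: singleton_columns_def)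
  have "{j. tableau_column j (insertion_tableau w) = [2]} = {d + e..<d + e + b}"
    unfolding col by (auto simp: nth split: if_splits)
  then show "singleton_columns 2 w = b" by (simp add: singleton_columns_def)
qed

lemma tableau_row_word_rows:
  assumes "word_rows w = (r, s, T)"
  shows "tableau_row 1 w = r" "tableau_row 2 w = s"
  using assms by (cases "insertion_tableau w" rule: split_tableau.cases; auto simp: word_rows_def tableau_row_def)+

lemma column_strict_two_letters: "column_strict (replicate a 1 @ replicate b 2) (replicate d 2) \<Longrightarrow> d \<le> a"
proof (induction d arbitrary: a)
  case (Suc d)
  then show ?case by (cases a; cases b) auto
qed simp

lemma word_rows_two_letter_rows:
  assumes "positive_word w" "word_rows w = (r, s, T)" "\<forall>x\<in>set r \<union> set s. x \<le> 2"
  shows "\<exists>e b d. word_rows w = two_letter_rows e b d T"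
proof -
  have tr: "two_rows r s" using word_rows_two_rows[OF assms(2)] .
  have "set r \<subseteq> {1, 2}"
    using subset_one_two_iff assms(3) word_rows_positive[OF assms(1,2)] by blast
  then obtain a b where r: "r = replicate a 1 @ replicate b 2"
    using sorted_two_letters[of r] tr by (auto simp: two_rows_def)
  have "\<forall>x\<in>set s. x = 2"
    using assms(3) word_rows_second_row[OF assms(1,2)] by (simp add: order_antisym)
  then have s: "s = replicate (length s) 2" by (metis replicate_length_same)
  then have "length s \<le> a"
    using column_strict_two_letters[of a b "length s"] tr r by (simp add: two_rows_def)
  \<comment> \<open>The bound \<open>length s \<le> a\<close> makes \<open>a - length s\<close> a
    true difference, with \<open>(a - length s) + length s = a\<close>.\<close>
  then have "word_rows w = two_letter_rows (a - length s) b (length s) T"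
    using assms(2) r s by (simp add: two_letter_rows_def)
  then show ?thesis by blast
qed

theorem theorem2p10:
  fixes u w :: word and n :: nat
  assumes "length u = n" and "set u \<subseteq> {1, 2}"
    and "1 \<le> count_list u 2" and "count_list u 2 < count_list u 1"
    and "positive_word w"
  shows "w \<in> plactic_centralizer u \<longleftrightarrow>
      ((singleton_columns 2 w = singleton_columns 2 u
          \<and> singleton_columns 2 u \<le> singleton_columns 1 w)
        \<or> (singleton_columns 1 w = singleton_columns 2 w
          \<and> singleton_columns 2 w < singleton_columns 2 u))
      \<and> (\<forall>i\<in>{1, 2}. tableau_row i w \<noteq> [] \<longrightarrow> Max (set (tableau_row i w)) \<le> 2)"
proof -
  obtain r s T where w: "word_rows w = (r, s, T)" by (metis prod_cases3)
  have rows: "(\<forall>i\<in>{1, 2}. tableau_row i w \<noteq> [] \<longrightarrow> Max (set (tableau_row i w)) \<le> 2)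
      \<longleftrightarrow> (\<forall>x\<in>set r \<union> set s. x \<le> 2)"
    using tableau_row_word_rows[OF w] by (auto simp: Max_le_iff)
  have letters: "1 \<in> set u" "2 \<in> set u"
    using assms(3,4) by (auto simp: count_list_0_iff intro: ccontr)
  show ?thesis
  proof (cases "\<forall>x\<in>set r \<union> set s. x \<le> 2")
    case False
    then have "w \<notin> plactic_centralizer u"
      using plactic_centralizer_iff[OF assms(5)] commuting_rows[OF assms(5,2) letters _ w] by blast
    then show ?thesis using False rows by blast
  next
    case True
    then obtain e b d where eb: "word_rows w = two_letter_rows e b d T"
      using word_rows_two_letter_rows[OF assms(5) w] by blast
    obtain p q k where u: "word_rows u = two_letter_rows p q k []"
        "count_list u 1 = p + k" "count_list u 2 = q + k"
      and uw: "word_rows (u @ w) = two_letter_rows (p + (e - q)) (b + (q - e)) (d + k + min q e) T"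
      using word_rows_two_letters_left[OF assms(2)] assms(5) eb by blast
    have "word_rows (w @ u) = two_letter_rows (e + (p - b)) (q + (b - p)) (d + k + min b p) T"
      using fold_insert3_two_letters[OF assms(2) u(1)] eb by (simp add: word_rows_append)
    \<comment> \<open>The two sides have the parameters \<open>p + e - m\<close>,
      \<open>b + q - m\<close>, \<open>d + k + m\<close> with \<open>m = min q e\<close> and
      \<open>m = min b p\<close> respectively.\<close>
    then have "w \<in> plactic_centralizer u \<longleftrightarrow> min q e = min b p"
      using uw plactic_centralizer_iff[OF assms(5)] by (auto simp: two_letter_rows_inject)
    moreover have "q < p" using assms(4) u by simp
    \<comment> \<open>As \<open>min q e \<le> q < p\<close>, equality forces
      \<open>min b p = b\<close>, that is, \<open>b = min q e\<close>.\<close>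
    then have "min q e = min b p \<longleftrightarrow> b = q \<and> q \<le> e \<or> e = b \<and> b < q" by linarith
    ultimately show ?thesis
      using True rows singleton_columns_two_letter_rows[OF eb] singleton_columns_two_letter_rows[OF u(1)]
      by simp
  qed
qed

end
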